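(* Let $p,q,r$ be positive integers, let $E\subseteq[p]\times[q]$, and let $M_E \in \mathbb{R}^E_{\geq 0}$ be a partial nonnegative matrix. Then $M_E$ has a nonnegative rank-$r$ completion if and only if there exist a member $(\hat P,\hat Q)$ of the family of nested cones associated to $M_E$ and an $r$-simplicial cone $\hat\Delta \subseteq \mathbb{R}^r$ such that $\hat P \subseteq \hat\Delta \subseteq \hat Q$.
   Context: $[n]=\{1,\dots,n\}$. A partial matrix $M_E \in \mathbb{R}^E$ specifies the entries in the positions $E\subseteq[p]\times[q]$; a completion of $M_E$ is a matrix in $\mathbb{R}^{p\times q}$ agreeing with $M_E$ on $E$, and a rank-$r$ completion is a completion of rank $r$. The nonnegative rank of $M\in\mathbb{R}_{\ge 0}^{p\times q}$ is the smallest $k$ such that $M=AB$ with $A\in\mathbb{R}_{\ge 0}^{p\times k}$, $B\in\mathbb{R}_{\ge 0}^{k\times q}$. A nonnegative rank-$r$ completion of $M_E$ is here a rank-$r$ completion of $M_E$ with nonnegative entries and nonnegative rank $r$. Family of nested cones associated to $M_E$: for every rank-$r$ completion $M$ of $M_E$ fix a factorization $M=AB$ with $A\in\mathbb{R}^{p\times r}$, $B\in\mathbb{R}^{r\times q}$ (entries of $A,B$ need not be nonnegative; the choice of factorization is arbitrary and the statement holds for any choice), and put $\hat P=\operatorname{cone}(B)\subseteq\mathbb{R}^r$, the conic hull of the columns of $B$, and $\hat Q=\{x\in\mathbb{R}^r : Ax\ge 0\}$. The family consists of all the pairs $(\hat P,\hat Q)$ so obtained for which $\hat P\subseteq\hat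 Q$ (equivalently, for which $M=AB$ has nonnegative entries). An $r$-simplicial cone in $\mathbb{R}^r$ is the conic hull of $r$ linearly independent vectors. *)

theory Defs
  imports "HOL-Analysis.Analysis"
begin

text \<open>
  The index sets \<open>[p]\<close>, \<open>[q]\<close>, \<open>[r]\<close> are finite types \<open>'p\<close>, \<open>'q\<close>, \<open>'r\<close>, so that
  \<open>p\<close>, \<open>q\<close>, \<open>r\<close> are their (positive) cardinalities and \<open>real^'q^'p\<close> is the type of
  \<open>p \<times> q\<close> matrices. The order on vectors and matrices is entrywise.

  The inner dimension \<open>k\<close> of a factorization varies in the definition of the nonnegative
  rank, so there the two factors are functions of which only the indices \<open>l < k\<close> are used.
\<close>

definition nonneg_factorization ::
    "real^'q^'p \<Rightarrow> nat \<Rightarrow> ('p \<Rightarrow> nat \<Rightarrow> real) \<Rightarrow> (nat \<Rightarrow> 'q \<Rightarrow> real) \<Rightarrow> bool" where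
  "nonneg_factorization M k A B \<longleftrightarrow>
     (\<forall>i. \<forall>l<k. 0 \<le> A i l) \<and> (\<forall>l<k. \<forall>j. 0 \<le> B l j) \<and>
     (\<forall>i j. M $ i $ j = (\<Sum>l<k. A i l * B l j))"

text \<open>Meaningful only for entrywise nonnegative matrices, for which a factorization exists.\<close>

definition nonneg_rank :: "real^'q^'p \<Rightarrow> nat" where
  "nonneg_rank M = (LEAST k. \<exists>A B. nonneg_factorization M k A B)"

definition is_completion :: "('p \<times> 'q) set \<Rightarrow> ('p \<times> 'q \<Rightarrow> real) \<Rightarrow> real^'q^'p \<Rightarrow> bool" where
  "is_completion E M\<^sub>E M \<longleftrightarrow> (\<forall>(i, j)\<in>E. M $ i $ j = M\<^sub>E (i, j))"

definition rank_completion ::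
    "nat \<Rightarrow> ('p::finite \<times> 'q::finite) set \<Rightarrow> ('p \<times> 'q \<Rightarrow> real) \<Rightarrow> real^'q^'p \<Rightarrow> bool" where
  "rank_completion r E M\<^sub>E M \<longleftrightarrow> is_completion E M\<^sub>E M \<and> rank M = r"

definition nonneg_rank_completion ::
    "nat \<Rightarrow> ('p::finite \<times> 'q::finite) set \<Rightarrow> ('p \<times> 'q \<Rightarrow> real) \<Rightarrow> real^'q^'p \<Rightarrow> bool" where
  "nonneg_rank_completion r E M\<^sub>E M \<longleftrightarrow>
     rank_completion r E M\<^sub>E M \<and> 0 \<le> M \<and> nonneg_rank M = r"

text \<open>
  The functions \<open>A\<close> and \<open>B\<close> select a factorization \<open>M = A M ** B M\<close>
  of every completion \<open>M\<close> of rank \<open>CARD('r)\<close>.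
\<close>

definition factorization_choice ::
    "('p::finite \<times> 'q::finite) set \<Rightarrow> ('p \<times> 'q \<Rightarrow> real) \<Rightarrow>
     (real^'q^'p \<Rightarrow> real^'r::finite^'p) \<Rightarrow> (real^'q^'p \<Rightarrow> real^'q^'r) \<Rightarrow> bool" where
  "factorization_choice E M\<^sub>E A B \<longleftrightarrow>
     (\<forall>M. rank_completion CARD('r) E M\<^sub>E M \<longrightarrow> M = A M ** B M)"

definition inner_cone :: "real^'q::finite^'r \<Rightarrow> (real^'r::finite) set" where
  "inner_cone B = convex_cone hull (columns B)"

definition outer_cone :: "real^'r::finite^'p \<Rightarrow> (real^'r) set" where
  "outer_cone A = {x. 0 \<le> A *v x}"

definition nested_cone_family ::
    "('p::finite \<times> 'q::finite) set \<Rightarrow> ('p \<times> 'q \<Rightarrow> real) \<Rightarrow>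
     (real^'q^'p \<Rightarrow> real^'r::finite^'p) \<Rightarrow> (real^'q^'p \<Rightarrow> real^'q^'r) \<Rightarrow>
     ((real^'r) set \<times> (real^'r) set) set" where
  "nested_cone_family E M\<^sub>E A B =
     {(inner_cone (B M), outer_cone (A M)) | M.
        rank_completion CARD('r) E M\<^sub>E M \<and> inner_cone (B M) \<subseteq> outer_cone (A M)}"

text \<open>
  The library's \<open>conic hull\<close> closes only under nonnegative scaling;
  the conic hull meant here is the set of all nonnegative combinations, \<open>convex_cone hull\<close>.
\<close>

definition simplicial_cone :: "nat \<Rightarrow> 'a::euclidean_space set \<Rightarrow> bool" where
  "simplicial_cone r \<Delta> \<longleftrightarrow> (\<exists>S. independent S \<and> card S = r \<and> \<Delta> = convex_cone hull S)"

end

theory Submission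
  imports Defs
begin

text \<open>
  Two factorizations \<open>M = A B = C D\<close> of a rank \<open>r\<close> matrix with inner dimension \<open>r\<close> differ by an
  invertible matrix \<open>S\<close>, that is \<open>C = A S\<close> and \<open>B = S D\<close>. The columns of \<open>S\<close> span a simplicial cone:
  it contains the columns of \<open>B\<close> iff \<open>D \<ge> 0\<close>, and it lies in \<open>{x. A x \<ge> 0}\<close> iff \<open>C \<ge> 0\<close>.
\<close>

section \<open>Entrywise nonnegativity and matrix products\<close>

lemma matrix_nonneg_iff:
  fixes M :: "real^'q^'p"
  shows "0 \<le> M \<longleftrightarrow> (\<forall>i j. 0 \<le> M $ i $ j)"
  by (simp add: less_eq_vec_def)

lemma matrix_mult_nonneg:
  fixes C :: "real^'r::finite^'p" and D :: "real^'q^'r"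
  assumes "0 \<le> C" "0 \<le> D"
  shows "0 \<le> C ** D"
  using assms by (auto simp: matrix_nonneg_iff matrix_matrix_mult_def intro!: sum_nonneg)

lemma matrix_vector_mult_nonneg:
  fixes C :: "real^'r::finite^'p"
  assumes "0 \<le> C" "0 \<le> y"
  shows "0 \<le> C *v y"
  using assms by (auto simp: less_eq_vec_def matrix_vector_mult_def intro!: sum_nonneg)

lemma column_matrix_mult: "column j (A ** B) = A *v column j B"
  by (simp add: vec_eq_iff column_def matrix_matrix_mult_def matrix_vector_mult_def)

text \<open>A linear image of the nonnegative orthant is a convex cone, and it contains the images
  of the basis vectors, which are the columns. Membership in the cone thus means that
  \<open>B *v y = x\<close> has a solution \<open>y \<ge> 0\<close>.\<close>

lemma inner_cone_eq_image:
  fixes B :: "real^'q::finite^'r::finite"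
  shows "inner_cone B = (*v) B ` {y. 0 \<le> y}"
proof
  have "convex_cone {y :: real^'q. 0 \<le> y}"
    by (auto simp: convex_cone_iff less_eq_vec_def)
  then have "convex_cone ((*v) B ` {y. 0 \<le> y})"
    by (simp add: convex_cone_linear_image)
  moreover have "columns B \<subseteq> (*v) B ` {y. 0 \<le> y}"
    by (auto simp: columns_image_basis less_eq_vec_def axis_def)
  ultimately show "inner_cone B \<subseteq> (*v) B ` {y. 0 \<le> y}"
    unfolding inner_cone_def by (simp add: hull_minimal)
next
  have "B *v y \<in> inner_cone B" if "0 \<le> y" for y
  proof -
    \<comment> \<open>Partial sums over arbitrary \<open>I\<close> make induction possible;
      \<open>I = UNIV\<close> gives \<open>B *v y\<close>. The empty sum is covered because the hull
      contains 0.\<close>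
    have "(\<Sum>i\<in>I. y $ i *\<^sub>R column i B) \<in> convex_cone hull columns B" if "finite I" for I
      using that \<open>0 \<le> y\<close>
      by (induction rule: finite_induct)
        (auto simp: convex_cone_hull_contains_0 columns_def less_eq_vec_def
          intro: convex_cone_hull_add convex_cone_hull_mul hull_inc)
    then show ?thesis
      by (simp add: inner_cone_def matrix_mult_sum scalar_mult_eq_scaleR)
  qed
  then show "(*v) B ` {y. 0 \<le> y} \<subseteq> inner_cone B"
    by auto
qed

lemma column_in_inner_cone: "column j B \<in> inner_cone B"
  by (auto simp: inner_cone_def columns_def intro: hull_inc)

text \<open>It suffices to test the columns of \<open>B\<close>: the nonnegative coefficients that
  express them in the columns of \<open>S\<close> are the columns of \<open>D\<close>.\<close>

lemma inner_cone_subset_inner_cone_iff: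
  fixes B :: "real^'q::finite^'r::finite" and S :: "real^'s::finite^'r"
  shows "inner_cone B \<subseteq> inner_cone S \<longleftrightarrow> (\<exists>D. 0 \<le> D \<and> B = S ** D)"
proof
  assume "inner_cone B \<subseteq> inner_cone S"
  then have "\<exists>y. 0 \<le> y \<and> column j B = S *v y" for j
    using column_in_inner_cone[of j B] by (auto simp: inner_cone_eq_image)
  then obtain d where d: "\<And>j. 0 \<le> d j" "\<And>j. column j B = S *v d j"
    by metis
  define D where "D = (\<chi> i j. d j $ i)"
  have "0 \<le> D"
    using d(1) by (simp add: D_def less_eq_vec_def)
  moreover have "column j D = d j" for j
    by (simp add: D_def column_def vec_eq_iff)
  then have "column j B = column j (S ** D)" for j
    by (simp add: column_matrix_mult d(2))
  then have "B = S ** D"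
    by (simp add: column_def vec_eq_iff)
  ultimately show "\<exists>D. 0 \<le> D \<and> B = S ** D"
    by blast
next
  assume "\<exists>D. 0 \<le> D \<and> B = S ** D"
  then show "inner_cone B \<subseteq> inner_cone S"
    by (auto simp: inner_cone_eq_image matrix_vector_mult_nonneg matrix_vector_mul_assoc[symmetric])
qed

text \<open>The columns of \<open>A ** S\<close> are the images under \<open>A\<close> of the
  generators of the inner cone.\<close>

lemma inner_cone_subset_outer_cone_iff:
  fixes S :: "real^'s::finite^'r::finite" and A :: "real^'r^'p::finite"
  shows "inner_cone S \<subseteq> outer_cone A \<longleftrightarrow> 0 \<le> A ** S"
proof
  assume "inner_cone S \<subseteq> outer_cone A"
  then have "0 \<le> column j (A ** S)" for j
    using column_in_inner_cone[of j S] by (auto simp: outer_cone_def column_matrix_mult)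
  then show "0 \<le> A ** S"
    by (simp add: less_eq_vec_def column_def)
next
  assume "0 \<le> A ** S"
  then show "inner_cone S \<subseteq> outer_cone A"
    by (auto simp: inner_cone_eq_image outer_cone_def matrix_vector_mul_assoc matrix_vector_mult_nonneg)
qed

section \<open>Simplicial cones and invertible matrices\<close>

lemma invertible_iff_full_rank:
  fixes S :: "real^'n^'n"
  shows "invertible S \<longleftrightarrow> rank S = CARD('n)"
  by (simp add: full_rank_injective invertible_left_inverse matrix_left_invertible_injective)

lemma simplicial_cone_iff_invertible:
  fixes \<Delta> :: "(real^'r::finite) set"
  shows "simplicial_cone CARD('r) \<Delta> \<longleftrightarrow> (\<exists>S :: real^'r^'r. invertible S \<and> \<Delta> = inner_cone S)"
proof
  assume "simplicial_cone CARD('r) \<Delta>"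
  then obtain V where V: "independent V" "card V = CARD('r)" "\<Delta> = convex_cone hull V"
    by (auto simp: simplicial_cone_def)
  have "finite V"
    using V(2) card.infinite by fastforce
  then obtain f where f: "bij_betw f (UNIV :: 'r set) V"
    using V(2) finite_same_card_bij by (metis finite)
  define S :: "real^'r^'r" where "S = (\<chi> i j. f j $ i)"
  have "column j S = f j" for j
    by (simp add: S_def column_def vec_eq_iff)
  then have "columns S = V"
    using f by (auto simp: columns_def bij_betw_def)
  then have "rank S = CARD('r)"
    using V by (simp add: column_rank_def dim_eq_card_independent)
  then show "\<exists>S :: real^'r^'r. invertible S \<and> \<Delta> = inner_cone S"
    using V(3) \<open>columns S = V\<close> by (auto simp: invertible_iff_full_rank inner_cone_def)
next
  assume "\<exists>S :: real^'r^'r. invertible S \<and> \<Delta> = inner_cone S"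
  then obtain S :: "real^'r^'r" where S: "rank S = CARD('r)" "\<Delta> = inner_cone S"
    by (auto simp: invertible_iff_full_rank)
  have "columns S = range (\<lambda>j. column j S)"
    by (auto simp: columns_def)
  then have fin: "finite (columns S)" and le: "card (columns S) \<le> CARD('r)"
    by (simp_all add: card_image_le)
  \<comment> \<open>\<open>columns S\<close> is a set, so repeated columns would collapse. At most r
    vectors spanning a space of dimension r are independent, and then there are exactly r of
    them.\<close>
  have "independent (columns S)"
    using S(1) le fin by (intro card_le_dim_spanning[of _ "columns S"])
      (auto simp: column_rank_def span_superset)
  moreover from this have "card (columns S) = CARD('r)"
    using S(1) by (simp add: column_rank_def dim_eq_card_independent)
  ultimately show "simplicial_cone CARD('r) \<Delta>"
    using S(2) by (auto simp: simplicial_cone_def inner_cone_def)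
qed

text \<open>Links the inner indices \<open>l < k\<close> from the definition of
  \<open>nonneg_rank\<close> with matrices indexed by the type \<open>'r\<close>, by transport along
  a bijection.\<close>

lemma nonneg_factorization_CARD_iff:
  fixes M :: "real^'q^'p"
  shows "(\<exists>A B. nonneg_factorization M CARD('r) A B) \<longleftrightarrow>
    (\<exists>(C :: real^'r::finite^'p) D. 0 \<le> C \<and> 0 \<le> D \<and> M = C ** D)"
proof -
  obtain f where f: "bij_betw f (UNIV :: 'r set) {..<CARD('r)}"
    using finite_same_card_bij[of "UNIV :: 'r set" "{..<CARD('r)}"] by auto
  then have f_less: "f l < CARD('r)" for l
    using bij_betwE by blast
  show ?thesis
  proof
    assume "\<exists>A B. nonneg_factorization M CARD('r) A B"
    then obtain A B where AB: "nonneg_factorization M CARD('r) A B"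
      by blast
    define C :: "real^'r^'p" where "C = (\<chi> i l. A i (f l))"
    define D :: "real^'q^'r" where "D = (\<chi> l j. B (f l) j)"
    have "0 \<le> C" "0 \<le> D"
      using AB f_less by (simp_all add: nonneg_factorization_def C_def D_def less_eq_vec_def)
    moreover have "M = C ** D"
      using AB sum.reindex_bij_betw[OF f, of "\<lambda>l. A i l * B l j" for i j]
      by (simp add: nonneg_factorization_def C_def D_def matrix_matrix_mult_def vec_eq_iff)
    ultimately show "\<exists>(C :: real^'r^'p) D. 0 \<le> C \<and> 0 \<le> D \<and> M = C ** D"
      by blast
  next
    assume "\<exists>(C :: real^'r^'p) D. 0 \<le> C \<and> 0 \<le> D \<and> M = C ** D"
    then obtain C :: "real^'r^'p" and D where CD: "0 \<le> C" "0 \<le> D" "M = C ** D"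
      by blast
    define g where "g = inv_into UNIV f"
    have "(\<Sum>l<CARD('r). C $ i $ g l * D $ g l $ j) = (\<Sum>l\<in>UNIV. C $ i $ l * D $ l $ j)" for i j
      using f by (subst sum.reindex_bij_betw[OF f, symmetric])
        (simp add: g_def bij_betw_def)
    then have "nonneg_factorization M CARD('r) (\<lambda>i l. C $ i $ g l) (\<lambda>l j. D $ g l $ j)"
      using CD by (simp add: nonneg_factorization_def less_eq_vec_def matrix_matrix_mult_def)
    then show "\<exists>A B. nonneg_factorization M CARD('r) A B"
      by blast
  qed
qed

text \<open>Every column of \<open>M\<close> is a combination of the k columns \<open>a l\<close> of
  the left factor.\<close>

lemma rank_le_of_nonneg_factorization:
  fixes M :: "real^'q::finite^'p::finite"
  assumes "nonneg_factorization M k A B"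
  shows "rank M \<le> k"
proof -
  define a :: "nat \<Rightarrow> real^'p" where "a l = (\<chi> i. A i l)" for l
  have "column j M = (\<Sum>l<k. B l j *\<^sub>R a l)" for j
    using assms by (simp add: nonneg_factorization_def a_def column_def vec_eq_iff mult.commute)
  then have "columns M \<subseteq> span (a ` {..<k})"
    by (auto simp: columns_def intro: span_sum span_scale span_base)
  then have "rank M \<le> card (a ` {..<k})"
    by (simp add: column_rank_def dim_le_card)
  also have "\<dots> \<le> k"
    using card_image_le[of "{..<k}" a] by simp
  finally show ?thesis .
qed

text \<open>The trivial factorization \<open>M ** mat 1\<close> shows that some inner dimension is
  possible, so the \<open>LEAST\<close> in \<open>nonneg_rank\<close> is attained.\<close>

lemma nonneg_factorization_nonneg_rank:
  fixes M :: "real^'q::finite^'p"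
  assumes "0 \<le> M"
  shows "\<exists>A B. nonneg_factorization M (nonneg_rank M) A B"
proof -
  have "0 \<le> (mat 1 :: real^'q^'q)"
    by (simp add: less_eq_vec_def mat_def)
  moreover have "M = M ** mat 1"
    by simp
  ultimately have "\<exists>A B. nonneg_factorization M CARD('q) A B"
    using assms nonneg_factorization_CARD_iff[where 'r = 'q] by blast
  then show ?thesis
    unfolding nonneg_rank_def by (rule LeastI)
qed

text \<open>The rank bounds every inner dimension from below, so a nonnegative factorization whose
  inner dimension equals the rank is automatically minimal.\<close>

lemma nonneg_rank_eq_rank_iff:
  fixes M :: "real^'q::finite^'p::finite"
  assumes "rank M = CARD('r)"
  shows "0 \<le> M \<and> nonneg_rank M = CARD('r) \<longleftrightarrow>
    (\<exists>(C :: real^'r::finite^'p) D. 0 \<le> C \<and> 0 \<le> D \<and> M = C ** D)"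
proof
  assume "0 \<le> M \<and> nonneg_rank M = CARD('r)"
  then show "\<exists>(C :: real^'r^'p) D. 0 \<le> C \<and> 0 \<le> D \<and> M = C ** D"
    using nonneg_factorization_nonneg_rank[of M] nonneg_factorization_CARD_iff[where 'r = 'r]
    by fastforce
next
  assume CD: "\<exists>(C :: real^'r^'p) D. 0 \<le> C \<and> 0 \<le> D \<and> M = C ** D"
  then have "nonneg_rank M = CARD('r)"
    unfolding nonneg_rank_def nonneg_factorization_CARD_iff[symmetric]
    using assms rank_le_of_nonneg_factorization[of M] by (intro Least_equality) auto
  with CD show "0 \<le> M \<and> nonneg_rank M = CARD('r)"
    by (auto simp: matrix_mult_nonneg)
qed

lemma full_rank_factorizations_eq_up_to_invertible:
  fixes A C :: "real^'r::finite^'p::finite" and B D :: "real^'q::finite^'r"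
  assumes AB: "M = A ** B" and CD: "M = C ** D" and "rank M = CARD('r)"
  obtains S where "invertible S" "C = A ** S" "B = S ** D"
proof -
  \<comment> \<open>The rank of each factor lies between \<open>rank M\<close> and the inner
    dimension, which coincide. Hence \<open>A\<close> is injective and \<open>D\<close> is
    surjective, which provides the one-sided inverses below.\<close>
  have "rank A = CARD('r)" "rank C = CARD('r)" "rank B = CARD('r)" "rank D = CARD('r)"
    using assms rank_mul_le_left[of A B] rank_mul_le_left[of C D]
      rank_mul_le_right[of A B] rank_mul_le_right[of C D]
      rank_bound[of A] rank_bound[of B] rank_bound[of C] rank_bound[of D] by auto
  then obtain A' :: "real^'p^'r" and D' :: "real^'r^'q"
    where A': "A' ** A = mat 1" and D': "D ** D' = mat 1"
    using matrix_left_invertible_injective matrix_right_invertible_surjective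
      full_rank_injective full_rank_surjective by metis
  \<comment> \<open>The choice is forced: multiply \<open>B = S ** D\<close> on the right by
    \<open>D'\<close>.\<close>
  define S where "S = B ** D'"
  have C_eq: "C = A ** S"
  proof -
    have "C = C ** D ** D'"
      by (simp add: D' flip: matrix_mul_assoc)
    also have "\<dots> = A ** S"
      by (simp add: S_def matrix_mul_assoc flip: AB CD)
    finally show ?thesis .
  qed
  have "B = S ** D"
  proof -
    have "B = A' ** (A ** B)"
      by (simp add: A' matrix_mul_assoc)
    also have "\<dots> = A' ** (A ** S ** D)"
      using AB CD C_eq by simp
    also have "\<dots> = S ** D"
      by (simp add: A' matrix_mul_assoc)
    finally show ?thesis .
  qed
  \<comment> \<open>Since \<open>C = A ** S\<close> has full rank, so has \<open>S\<close>.\<close>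
  moreover have "invertible S"
    using rank_mul_le_right[of A S] rank_bound[of S] \<open>rank C = CARD('r)\<close> C_eq
    by (simp add: invertible_iff_full_rank)
  ultimately show ?thesis
    using that C_eq by blast
qed

lemma nonneg_factorization_iff_simplicial_cone_between:
  fixes A :: "real^'r::finite^'p::finite" and B :: "real^'q::finite^'r"
  assumes "M = A ** B" "rank M = CARD('r)"
  shows "(\<exists>(C :: real^'r^'p) D. 0 \<le> C \<and> 0 \<le> D \<and> M = C ** D) \<longleftrightarrow>
    (\<exists>\<Delta>. simplicial_cone CARD('r) \<Delta> \<and> inner_cone B \<subseteq> \<Delta> \<and> \<Delta> \<subseteq> outer_cone A)"
proof
  assume "\<exists>(C :: real^'r^'p) D. 0 \<le> C \<and> 0 \<le> D \<and> M = C ** D"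
  then obtain C :: "real^'r^'p" and D where CD: "0 \<le> C" "0 \<le> D" "M = C ** D"
    by blast
  obtain S where "invertible S" "C = A ** S" "B = S ** D"
    using full_rank_factorizations_eq_up_to_invertible[OF assms(1) CD(3) assms(2)] .
  then show "\<exists>\<Delta>. simplicial_cone CARD('r) \<Delta> \<and> inner_cone B \<subseteq> \<Delta> \<and> \<Delta> \<subseteq> outer_cone A"
    using CD inner_cone_subset_inner_cone_iff[of B S] inner_cone_subset_outer_cone_iff[of S A]
    by (auto simp: simplicial_cone_iff_invertible)
next
  assume "\<exists>\<Delta>. simplicial_cone CARD('r) \<Delta> \<and> inner_cone B \<subseteq> \<Delta> \<and> \<Delta> \<subseteq> outer_cone A"
  then obtain S :: "real^'r^'r" where "inner_cone B \<subseteq> inner_cone S" "inner_cone S \<subseteq> outer_cone A"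
    by (auto simp: simplicial_cone_iff_invertible)
  \<comment> \<open>The generators of the cone regroup the product: \<open>A ** S\<close> and
    \<open>D\<close> are the nonnegative factors.\<close>
  then obtain D where "0 \<le> D" "B = S ** D" "0 \<le> A ** S"
    by (auto simp: inner_cone_subset_inner_cone_iff inner_cone_subset_outer_cone_iff)
  moreover from this have "M = (A ** S) ** D"
    using assms(1) by (simp add: matrix_mul_assoc)
  ultimately show "\<exists>(C :: real^'r^'p) D. 0 \<le> C \<and> 0 \<le> D \<and> M = C ** D"
    by blast
qed

theorem theorem5p2:
  fixes E :: "('p::finite \<times> 'q::finite) set"
    and M\<^sub>E :: "'p \<times> 'q \<Rightarrow> real"
    and A :: "real^'q^'p \<Rightarrow> real^'r::finite^'p"
    and B :: "real^'q^'p \<Rightarrow> real^'q^'r"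
  assumes "M\<^sub>E \<in> E \<rightarrow>\<^sub>E {0..}"
    and "factorization_choice E M\<^sub>E A B"
  shows "(\<exists>M. nonneg_rank_completion CARD('r) E M\<^sub>E M) \<longleftrightarrow>
         (\<exists>P Q \<Delta>. (P, Q) \<in> nested_cone_family E M\<^sub>E A B \<and>
            simplicial_cone CARD('r) \<Delta> \<and> P \<subseteq> \<Delta> \<and> \<Delta> \<subseteq> Q)"
proof -
  \<comment> \<open>The equivalence holds for each \<open>M\<close> separately, with whatever
    factorization was chosen for it.\<close>
  have "nonneg_rank_completion CARD('r) E M\<^sub>E M \<longleftrightarrow> rank_completion CARD('r) E M\<^sub>E M \<and>
      (\<exists>\<Delta>. simplicial_cone CARD('r) \<Delta> \<and> inner_cone (B M) \<subseteq> \<Delta> \<and> \<Delta> \<subseteq> outer_cone (A M))" for M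
  proof (cases "rank_completion CARD('r) E M\<^sub>E M")
    case True
    then have "M = A M ** B M" and rank: "rank M = CARD('r)"
      using assms(2) by (auto simp: factorization_choice_def rank_completion_def)
    from nonneg_factorization_iff_simplicial_cone_between[OF this] nonneg_rank_eq_rank_iff[OF rank]
    show ?thesis
      using True by (simp add: nonneg_rank_completion_def)
  qed (simp add: nonneg_rank_completion_def)
  \<comment> \<open>The nesting \<open>P \<subseteq> Q\<close> demanded by the family follows by
    transitivity through \<open>\<Delta>\<close>.\<close>
  moreover have "(\<exists>P Q \<Delta>. (P, Q) \<in> nested_cone_family E M\<^sub>E A B \<and>
        simplicial_cone CARD('r) \<Delta> \<and> P \<subseteq> \<Delta> \<and> \<Delta> \<subseteq> Q) \<longleftrightarrow>
      (\<exists>M. rank_completion CARD('r) E M\<^sub>E M \<and>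
        (\<exists>\<Delta>. simplicial_cone CARD('r) \<Delta> \<and> inner_cone (B M) \<subseteq> \<Delta> \<and> \<Delta> \<subseteq> outer_cone (A M)))"
    unfolding nested_cone_family_def by blast
  ultimately show ?thesis
    by simp
qed

end
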